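(* In the setting below, if $\gamma$ is a proper generalizer, then $\mathrm{GCG}_{\simeq}(\Phi,\psi,\overset{\simeq}{\gamma})$ is sound, terminating, and complete up to isomorphisms; that is: every execution terminates; every output $\sigma$ satisfies $\sigma\models\Phi$ and $M_\sigma\models\psi$; and for every assignment $\rho$ with $\rho\models\Phi$ and $M_\rho\models\psi$, every execution outputs some $\sigma$ with $\sigma\simeq\rho$.
   Context: LTS setting. A labeled transition system (LTS) is $\langle\Sigma,Q,Q_0,\Delta\rangle$ (finite labels $\Sigma$, finite states $Q$, initial states $Q_0\subseteq Q$, $\Delta\subseteq Q\times\Sigma\times Q$). Fix an LTS $M_0=\langle\Sigma,Q,Q_0,\Delta_0\rangle$; a completion of $M_0$ is an LTS with the same $\Sigma,Q,Q_0$ and transition relation $\Delta\supseteq\Delta_0$. Let $V=\{x_{p,a,q}: p,q\in Q, a\in\Sigma\}$; an assignment $\sigma:V\to\{0,1\}$ encodes the LTS $M_\sigma$ with $\Sigma,Q,Q_0$ and $\Delta_\sigma=\{(p,a,q):\sigma(x_{p,a,q})=1\}$. $\Phi$ is a propositional formula over $V$ that implies $\bigwedge_{(p,a,q)\in\Delta_0}x_{p,a,q}$. Let $A$ be the set of non-initial states of $M_0$ with no incoming or outgoing transitions in $\Delta_0$. For assignments $\sigma,\rho$ satisfying $\Phi$, $\sigma\simeq\rho$ means there is a bijection $f:Q\to Q$ with $f(q)=q$ for $q\notin A$ such that $(p,a,q)\in\Delta_\sigma$ iff $(f(p),a,f(q))\in\Delta_\rho$. For $\rho\models\Phi$, $[\rho]=\{\sigma:\sigma\models\Phi,\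 \sigma\simeq\rho\}$, also viewed as the formula satisfied exactly by its elements. $\psi$ is a specification with satisfaction relation $M\models\psi$, assumed invariant under isomorphism: if $\sigma\simeq\rho$ then $M_\sigma\models\psi$ iff $M_\rho\models\psi$. A generalizer maps assignments to formulas over $V$; $\gamma$ is proper if for every $\sigma\models\Phi$ with $M_\sigma\not\models\psi$: $\sigma\models\gamma(\sigma)$, and no $\rho$ with $\rho\models\Phi$, $M_\rho\models\psi$ satisfies $\gamma(\sigma)$. The equivalence closure of $\gamma$ is the generalizer $\overset{\simeq}{\gamma}(\rho):=\bigvee_{\sigma\in[\rho]}\gamma(\sigma)$. Algorithm $\mathrm{GCG}_{\simeq}(\Phi,\psi,g)$ for a generalizer $g$: keep $\Phi_{cur}:=\Phi$; while $\Phi_{cur}$ is satisfiable, pick an arbitrary $\sigma\models\Phi_{cur}$; if $M_\sigma\models\psi$, output $\sigma$ and set $\Phi_{cur}:=\Phi_{cur}\wedge\neg[\sigma]$; else set $\Phi_{cur}:=\Phi_{cur}\wedge\neg g(\sigma)$. *)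

theory Defs
  imports Main "HOL-Library.FSet" "HOL-Library.FuncSet"
begin

datatype (atoms: 'v) form =
    Atom 'v
  | Neg "'v form"
  | Conj "'v form fset"
  | Disj "'v form fset"

function (sequential) sat :: "('v \<Rightarrow> bool) \<Rightarrow> 'v form \<Rightarrow> bool" (infix "\<Turnstile>" 50) where
  "\<sigma> \<Turnstile> Atom v \<longleftrightarrow> \<sigma> v"
| "\<sigma> \<Turnstile> Neg \<phi> \<longleftrightarrow> \<not> \<sigma> \<Turnstile> \<phi>"
| "\<sigma> \<Turnstile> Conj F \<longleftrightarrow> (\<forall>\<phi> |\<in>| F. \<sigma> \<Turnstile> \<phi>)"
| "\<sigma> \<Turnstile> Disj F \<longleftrightarrow> (\<exists>\<phi> |\<in>| F. \<sigma> \<Turnstile> \<phi>)"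
  by pat_completeness auto
termination
proof (relation "measure (size \<circ> snd)", simp_all)
  fix F :: "'v form fset" and \<phi>
  assume "\<phi> |\<in>| F"
  then have "Suc (size \<phi>) \<le> (\<Sum>\<chi>\<in>fset F. Suc (size \<chi>))"
    by (intro member_le_sum) auto
  then show "size \<phi> < Suc (\<Sum>\<chi>\<in>fset F. Suc (size \<chi>))"
    and "size \<phi> < Suc (\<Sum>\<chi>\<in>fset F. Suc (size \<chi>))"
    by simp_all
qed

abbreviation And :: "'v form \<Rightarrow> 'v form \<Rightarrow> 'v form" where
  "And \<phi> \<chi> \<equiv> Conj {|\<phi>, \<chi>|}"

text \<open>Indexed connectives; meaningful for finite index sets only, since
  \<^const>\<open>Abs_fset\<close> is unspecified on infinite sets.\<close>

definition BigConj :: "'i set \<Rightarrow> ('i \<Rightarrow> 'v form) \<Rightarrow> 'v form" where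
  "BigConj I \<phi> = Conj (Abs_fset (\<phi> ` I))"

definition BigDisj :: "'i set \<Rightarrow> ('i \<Rightarrow> 'v form) \<Rightarrow> 'v form" where
  "BigDisj I \<phi> = Disj (Abs_fset (\<phi> ` I))"

lemma sat_BigConj: "finite I \<Longrightarrow> \<sigma> \<Turnstile> BigConj I \<phi> \<longleftrightarrow> (\<forall>i\<in>I. \<sigma> \<Turnstile> \<phi> i)"
  by (simp add: BigConj_def Abs_fset_inverse)

lemma sat_BigDisj: "finite I \<Longrightarrow> \<sigma> \<Turnstile> BigDisj I \<phi> \<longleftrightarrow> (\<exists>i\<in>I. \<sigma> \<Turnstile> \<phi> i)"
  by (simp add: BigDisj_def Abs_fset_inverse)

text \<open>Assignments are functions on \<open>V\<close>, made extensional so that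
  they are determined by their values on \<open>V\<close>.\<close>

definition assignments :: "'v set \<Rightarrow> ('v \<Rightarrow> bool) set" where
  "assignments V = V \<rightarrow>\<^sub>E UNIV"

definition formula_over :: "'v set \<Rightarrow> 'v form \<Rightarrow> bool" where
  "formula_over V \<phi> \<longleftrightarrow> atoms \<phi> \<subseteq> V"

definition satisfiable :: "'v set \<Rightarrow> 'v form \<Rightarrow> bool" where
  "satisfiable V \<phi> \<longleftrightarrow> (\<exists>\<sigma>\<in>assignments V. \<sigma> \<Turnstile> \<phi>)"

definition entails :: "'v set \<Rightarrow> 'v form \<Rightarrow> 'v form \<Rightarrow> bool" where
  "entails V \<phi> \<chi> \<longleftrightarrow> (\<forall>\<sigma>\<in>assignments V. \<sigma> \<Turnstile> \<phi> \<longrightarrow> \<sigma> \<Turnstile> \<chi>)"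

definition cube :: "'v set \<Rightarrow> ('v \<Rightarrow> bool) \<Rightarrow> 'v form" where
  "cube V \<sigma> = BigConj V (\<lambda>v. if \<sigma> v then Atom v else Neg (Atom v))"

lemma sat_cube:
  assumes "finite V" "\<sigma> \<in> assignments V" "\<rho> \<in> assignments V"
  shows "\<rho> \<Turnstile> cube V \<sigma> \<longleftrightarrow> \<rho> = \<sigma>"
proof
  assume "\<rho> \<Turnstile> cube V \<sigma>"
  then have "\<rho> v = \<sigma> v" if "v \<in> V" for v
    using that assms(1) by (auto simp: cube_def sat_BigConj split: if_splits)
  then show "\<rho> = \<sigma>"
    using assms(2,3) by (auto simp: assignments_def intro: PiE_ext)
next
  assume "\<rho> = \<sigma>"
  then show "\<rho> \<Turnstile> cube V \<sigma>"
    using assms(1) by (simp add: cube_def sat_BigConj)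
qed

record ('a, 'q) lts =
  labels :: "'a set"
  states :: "'q set"
  inits :: "'q set"
  transitions :: "('q \<times> 'a \<times> 'q) set"

definition wf_lts :: "('a, 'q) lts \<Rightarrow> bool" where
  "wf_lts M \<longleftrightarrow> finite (labels M) \<and> finite (states M) \<and> inits M \<subseteq> states M
     \<and> transitions M \<subseteq> states M \<times> labels M \<times> states M"

text \<open>The propositional variable \<open>x\<^bsub>p,a,q\<^esub>\<close> is represented by the triple \<open>(p, a, q)\<close> itself.\<close>

type_synonym ('a, 'q) assignment = "'q \<times> 'a \<times> 'q \<Rightarrow> bool"
type_synonym ('a, 'q) tform = "('q \<times> 'a \<times> 'q) form"

definition vars :: "('a, 'q) lts \<Rightarrow> ('q \<times> 'a \<times> 'q) set" where
  "vars M\<^sub>0 = states M\<^sub>0 \<times> labels M\<^sub>0 \<times> states M\<^sub>0"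

definition lts_of :: "('a, 'q) lts \<Rightarrow> ('a, 'q) assignment \<Rightarrow> ('a, 'q) lts" where
  "lts_of M\<^sub>0 \<sigma> = M\<^sub>0\<lparr>transitions := {t \<in> vars M\<^sub>0. \<sigma> t}\<rparr>"

definition isolated :: "('a, 'q) lts \<Rightarrow> 'q set" where
  "isolated M\<^sub>0 = {q \<in> states M\<^sub>0 - inits M\<^sub>0.
     \<forall>a p. (q, a, p) \<notin> transitions M\<^sub>0 \<and> (p, a, q) \<notin> transitions M\<^sub>0}"

definition models_of :: "('a, 'q) lts \<Rightarrow> ('a, 'q) tform \<Rightarrow> ('a, 'q) assignment set" where
  "models_of M\<^sub>0 \<Phi> = {\<sigma> \<in> assignments (vars M\<^sub>0). \<sigma> \<Turnstile> \<Phi>}"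

definition asg_equiv ::
  "('a, 'q) lts \<Rightarrow> ('a, 'q) tform \<Rightarrow> ('a, 'q) assignment \<Rightarrow> ('a, 'q) assignment \<Rightarrow> bool" where
  "asg_equiv M\<^sub>0 \<Phi> \<sigma> \<rho> \<longleftrightarrow> \<sigma> \<in> models_of M\<^sub>0 \<Phi> \<and> \<rho> \<in> models_of M\<^sub>0 \<Phi> \<and>
     (\<exists>f. bij_betw f (states M\<^sub>0) (states M\<^sub>0) \<and>
          (\<forall>q \<in> states M\<^sub>0 - isolated M\<^sub>0. f q = q) \<and>
          (\<forall>p \<in> states M\<^sub>0. \<forall>a \<in> labels M\<^sub>0. \<forall>q \<in> states M\<^sub>0.
             (p, a, q) \<in> transitions (lts_of M\<^sub>0 \<sigma>) \<longleftrightarrow> (f p, a, f q) \<in> transitions (lts_of M\<^sub>0 \<rho>)))"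

definition eq_class ::
  "('a, 'q) lts \<Rightarrow> ('a, 'q) tform \<Rightarrow> ('a, 'q) assignment \<Rightarrow> ('a, 'q) assignment set" where
  "eq_class M\<^sub>0 \<Phi> \<rho> = {\<sigma> \<in> models_of M\<^sub>0 \<Phi>. asg_equiv M\<^sub>0 \<Phi> \<sigma> \<rho>}"

definition class_form ::
  "('a, 'q) lts \<Rightarrow> ('a, 'q) tform \<Rightarrow> ('a, 'q) assignment \<Rightarrow> ('a, 'q) tform" where
  "class_form M\<^sub>0 \<Phi> \<rho> = BigDisj (eq_class M\<^sub>0 \<Phi> \<rho>) (cube (vars M\<^sub>0))"

lemma sat_class_form:
  assumes "wf_lts M\<^sub>0" "\<sigma> \<in> assignments (vars M\<^sub>0)"
  shows "\<sigma> \<Turnstile> class_form M\<^sub>0 \<Phi> \<rho> \<longleftrightarrow> \<sigma> \<in> eq_class M\<^sub>0 \<Phi> \<rho>"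
proof -
  have V: "finite (vars M\<^sub>0)"
    using assms(1) by (simp add: wf_lts_def vars_def)
  have sub: "eq_class M\<^sub>0 \<Phi> \<rho> \<subseteq> assignments (vars M\<^sub>0)"
    by (auto simp: eq_class_def models_of_def)
  have "finite (assignments (vars M\<^sub>0))"
    unfolding assignments_def using V by (simp add: finite_PiE)
  then have "finite (eq_class M\<^sub>0 \<Phi> \<rho>)"
    using sub by (rule rev_finite_subset)
  then show ?thesis
    using V sub assms(2) by (auto simp: class_form_def sat_BigDisj sat_cube subset_iff)
qed

type_synonym ('a, 'q) generalizer = "('a, 'q) assignment \<Rightarrow> ('a, 'q) tform"

definition is_generalizer :: "('a, 'q) lts \<Rightarrow> ('a, 'q) generalizer \<Rightarrow> bool" where
  "is_generalizer M\<^sub>0 \<gamma> \<longleftrightarrow>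
     (\<forall>\<sigma> \<in> assignments (vars M\<^sub>0). formula_over (vars M\<^sub>0) (\<gamma> \<sigma>))"

text \<open>Here and below, \<open>S\<close> is the satisfaction relation between systems and specifications.\<close>

definition proper ::
  "('a, 'q) lts \<Rightarrow> ('a, 'q) tform \<Rightarrow> (('a, 'q) lts \<Rightarrow> 'spec \<Rightarrow> bool) \<Rightarrow> 'spec
    \<Rightarrow> ('a, 'q) generalizer \<Rightarrow> bool" where
  "proper M\<^sub>0 \<Phi> S \<psi> \<gamma> \<longleftrightarrow>
     (\<forall>\<sigma> \<in> models_of M\<^sub>0 \<Phi>. \<not> S (lts_of M\<^sub>0 \<sigma>) \<psi> \<longrightarrow>
        \<sigma> \<Turnstile> \<gamma> \<sigma> \<and> \<not> (\<exists>\<rho> \<in> models_of M\<^sub>0 \<Phi>. S (lts_of M\<^sub>0 \<rho>) \<psi> \<and> \<rho> \<Turnstile> \<gamma> \<sigma>))"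

definition equiv_closure ::
  "('a, 'q) lts \<Rightarrow> ('a, 'q) tform \<Rightarrow> ('a, 'q) generalizer \<Rightarrow> ('a, 'q) generalizer" where
  "equiv_closure M\<^sub>0 \<Phi> \<gamma> \<rho> = BigDisj (eq_class M\<^sub>0 \<Phi> \<rho>) \<gamma>"

text \<open>A configuration consists of the current formula and the list of outputs so far. One step is
  one iteration of the loop; the choice of \<open>\<sigma>\<close> is nondeterministic, and the loop is left
  exactly in the configurations whose formula is unsatisfiable.\<close>

type_synonym ('a, 'q) config = "('a, 'q) tform \<times> ('a, 'q) assignment list"

inductive gcg_step ::
  "('a, 'q) lts \<Rightarrow> ('a, 'q) tform \<Rightarrow> (('a, 'q) lts \<Rightarrow> 'spec \<Rightarrow> bool) \<Rightarrow> 'spec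
    \<Rightarrow> ('a, 'q) generalizer \<Rightarrow> ('a, 'q) config \<Rightarrow> ('a, 'q) config \<Rightarrow> bool"
  for M\<^sub>0 \<Phi> S \<psi> g where
  report: "\<sigma> \<in> models_of M\<^sub>0 \<Phi>cur \<Longrightarrow> S (lts_of M\<^sub>0 \<sigma>) \<psi> \<Longrightarrow>
    gcg_step M\<^sub>0 \<Phi> S \<psi> g (\<Phi>cur, outs) (And \<Phi>cur (Neg (class_form M\<^sub>0 \<Phi> \<sigma>)), outs @ [\<sigma>])"
| exclude: "\<sigma> \<in> models_of M\<^sub>0 \<Phi>cur \<Longrightarrow> \<not> S (lts_of M\<^sub>0 \<sigma>) \<psi> \<Longrightarrow>
    gcg_step M\<^sub>0 \<Phi> S \<psi> g (\<Phi>cur, outs) (And \<Phi>cur (Neg (g \<sigma>)), outs)"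

definition gcg_init :: "('a, 'q) tform \<Rightarrow> ('a, 'q) config" where
  "gcg_init \<Phi> = (\<Phi>, [])"

definition gcg_terminating ::
  "('a, 'q) lts \<Rightarrow> ('a, 'q) tform \<Rightarrow> (('a, 'q) lts \<Rightarrow> 'spec \<Rightarrow> bool) \<Rightarrow> 'spec
    \<Rightarrow> ('a, 'q) generalizer \<Rightarrow> bool" where
  "gcg_terminating M\<^sub>0 \<Phi> S \<psi> g \<longleftrightarrow>
     \<not> (\<exists>c :: nat \<Rightarrow> ('a, 'q) config.
          c 0 = gcg_init \<Phi> \<and> (\<forall>i. gcg_step M\<^sub>0 \<Phi> S \<psi> g (c i) (c (Suc i))))"

definition gcg_sound ::
  "('a, 'q) lts \<Rightarrow> ('a, 'q) tform \<Rightarrow> (('a, 'q) lts \<Rightarrow> 'spec \<Rightarrow> bool) \<Rightarrow> 'spec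
    \<Rightarrow> ('a, 'q) generalizer \<Rightarrow> bool" where
  "gcg_sound M\<^sub>0 \<Phi> S \<psi> g \<longleftrightarrow>
     (\<forall>\<Phi>' outs. (gcg_step M\<^sub>0 \<Phi> S \<psi> g)\<^sup>*\<^sup>* (gcg_init \<Phi>) (\<Phi>', outs) \<longrightarrow>
        (\<forall>\<sigma> \<in> set outs. \<sigma> \<in> models_of M\<^sub>0 \<Phi> \<and> S (lts_of M\<^sub>0 \<sigma>) \<psi>))"

text \<open>A finished execution is a finite run whose last formula is unsatisfiable; together with
  \<^const>\<open>gcg_terminating\<close> these are all executions.\<close>

definition gcg_complete_upto_iso ::
  "('a, 'q) lts \<Rightarrow> ('a, 'q) tform \<Rightarrow> (('a, 'q) lts \<Rightarrow> 'spec \<Rightarrow> bool) \<Rightarrow> 'spec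
    \<Rightarrow> ('a, 'q) generalizer \<Rightarrow> bool" where
  "gcg_complete_upto_iso M\<^sub>0 \<Phi> S \<psi> g \<longleftrightarrow>
     (\<forall>\<rho> \<in> models_of M\<^sub>0 \<Phi>. S (lts_of M\<^sub>0 \<rho>) \<psi> \<longrightarrow>
        (\<forall>\<Phi>' outs. (gcg_step M\<^sub>0 \<Phi> S \<psi> g)\<^sup>*\<^sup>* (gcg_init \<Phi>) (\<Phi>', outs) \<and>
             \<not> satisfiable (vars M\<^sub>0) \<Phi>' \<longrightarrow>
           (\<exists>\<sigma> \<in> set outs. asg_equiv M\<^sub>0 \<Phi> \<sigma> \<rho>)))"

end

theory Submission
  imports Defs
begin

text \<open>A proper generalizer excludes the counterexample it is applied to and no solution, and the
  equivalence closure of a proper generalizer is again proper because satisfaction is constant on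
  equivalence classes. For any proper generalizer each iteration removes the chosen assignment from
  the finite set of models of the current formula, and a solution is removed only together with
  the equivalence class of an output.\<close>

lemma models_of_And_Neg:
  "models_of M\<^sub>0 (And \<phi> (Neg \<chi>)) = {\<sigma> \<in> models_of M\<^sub>0 \<phi>. \<not> \<sigma> \<Turnstile> \<chi>}"
  by (auto simp: models_of_def)

lemma finite_models_of:
  assumes "wf_lts M\<^sub>0"
  shows "finite (models_of M\<^sub>0 \<phi>)"
proof -
  have "finite (assignments (vars M\<^sub>0))"
    using assms by (simp add: assignments_def wf_lts_def vars_def finite_PiE)
  then show ?thesis
    by (simp add: models_of_def)
qed

lemma satisfiable_iff_models_of: "satisfiable (vars M\<^sub>0) \<phi> \<longleftrightarrow> models_of M\<^sub>0 \<phi> \<noteq> {}"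
  by (auto simp: satisfiable_def models_of_def)

lemma asg_equiv_refl: "\<sigma> \<in> models_of M\<^sub>0 \<Phi> \<Longrightarrow> asg_equiv M\<^sub>0 \<Phi> \<sigma> \<sigma>"
  unfolding asg_equiv_def by (auto intro!: exI[of _ id])

text \<open>The inverse of the witnessing bijection on the states is again a witness. Symmetry
  matters because \<open>eq_class\<close> places the member on the left, while completeness asks for
  the output on the left.\<close>

lemma asg_equiv_sym:
  assumes "asg_equiv M\<^sub>0 \<Phi> \<sigma> \<rho>"
  shows "asg_equiv M\<^sub>0 \<Phi> \<rho> \<sigma>"
proof -
  let ?Q = "states M\<^sub>0"
  obtain f where bij: "bij_betw f ?Q ?Q"
    and fixed: "\<forall>q \<in> ?Q - isolated M\<^sub>0. f q = q"
    and trans: "\<forall>p \<in> ?Q. \<forall>a \<in> labels M\<^sub>0. \<forall>q \<in> ?Q.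
      (p, a, q) \<in> transitions (lts_of M\<^sub>0 \<sigma>) \<longleftrightarrow> (f p, a, f q) \<in> transitions (lts_of M\<^sub>0 \<rho>)"
    using assms unfolding asg_equiv_def by blast
  let ?g = "inv_into ?Q f"
  have g: "?g q \<in> ?Q" "f (?g q) = q" if "q \<in> ?Q" for q
    using bij that by (auto simp: bij_betw_def inv_into_into f_inv_into_f)
  have "?g q = q" if "q \<in> ?Q - isolated M\<^sub>0" for q
    using bij fixed that by (metis DiffD1 bij_betw_inv_into_left)
  \<comment> \<open>This is \<open>trans\<close> at the states \<open>?g p\<close> and
    \<open>?g q\<close>, where \<open>f\<close> undoes \<open>?g\<close>.\<close>
  moreover have "(p, a, q) \<in> transitions (lts_of M\<^sub>0 \<rho>) \<longleftrightarrow>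
      (?g p, a, ?g q) \<in> transitions (lts_of M\<^sub>0 \<sigma>)"
    if "p \<in> ?Q" "a \<in> labels M\<^sub>0" "q \<in> ?Q" for p a q
    using trans that g by simp
  ultimately show ?thesis
    using assms bij_betw_inv_into[OF bij] unfolding asg_equiv_def by blast
qed

text \<open>Finiteness of the class is what gives \<open>BigDisj\<close> its intended meaning; the
  class lies inside the finite set of models of \<open>\<Phi>\<close>.\<close>

lemma sat_equiv_closure:
  assumes "wf_lts M\<^sub>0"
  shows "\<sigma> \<Turnstile> equiv_closure M\<^sub>0 \<Phi> \<gamma> \<rho> \<longleftrightarrow> (\<exists>\<tau> \<in> eq_class M\<^sub>0 \<Phi> \<rho>. \<sigma> \<Turnstile> \<gamma> \<tau>)"
proof -
  have "finite (eq_class M\<^sub>0 \<Phi> \<rho>)"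
    using finite_models_of[OF assms] by (simp add: eq_class_def)
  then show ?thesis
    by (simp add: equiv_closure_def sat_BigDisj)
qed

text \<open>By reflexivity, \<open>\<gamma> \<sigma>\<close> is itself a disjunct of the closure at
  a counterexample \<open>\<sigma>\<close>. Every other disjunct is \<open>\<gamma> \<tau>\<close>
  with \<open>\<tau>\<close> equivalent to \<open>\<sigma>\<close>; by invariance
  \<open>\<tau>\<close> is a counterexample too, so properness at \<open>\<tau>\<close> keeps
  solutions out.\<close>

lemma proper_equiv_closure:
  assumes wf: "wf_lts M\<^sub>0"
    and inv: "\<And>\<sigma> \<rho>. asg_equiv M\<^sub>0 \<Phi> \<sigma> \<rho> \<Longrightarrow> S (lts_of M\<^sub>0 \<sigma>) \<psi> \<longleftrightarrow> S (lts_of M\<^sub>0 \<rho>) \<psi>"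
    and proper: "proper M\<^sub>0 \<Phi> S \<psi> \<gamma>"
  shows "proper M\<^sub>0 \<Phi> S \<psi> (equiv_closure M\<^sub>0 \<Phi> \<gamma>)"
  unfolding proper_def
proof (intro ballI impI conjI notI)
  fix \<sigma> assume \<sigma>: "\<sigma> \<in> models_of M\<^sub>0 \<Phi>" "\<not> S (lts_of M\<^sub>0 \<sigma>) \<psi>"
  then show "\<sigma> \<Turnstile> equiv_closure M\<^sub>0 \<Phi> \<gamma> \<sigma>"
    using proper by (auto simp: sat_equiv_closure[OF wf] eq_class_def proper_def
        intro!: bexI[of _ \<sigma>] asg_equiv_refl)
  assume "\<exists>\<rho> \<in> models_of M\<^sub>0 \<Phi>. S (lts_of M\<^sub>0 \<rho>) \<psi> \<and> \<rho> \<Turnstile> equiv_closure M\<^sub>0 \<Phi> \<gamma> \<sigma>"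
  then obtain \<rho> \<tau> where "\<rho> \<in> models_of M\<^sub>0 \<Phi>" "S (lts_of M\<^sub>0 \<rho>) \<psi>"
    and "\<tau> \<in> eq_class M\<^sub>0 \<Phi> \<sigma>" "\<rho> \<Turnstile> \<gamma> \<tau>"
    by (auto simp: sat_equiv_closure[OF wf])
  then show False
    using \<sigma>(2) inv[of \<tau> \<sigma>] proper by (auto simp: eq_class_def proper_def)
qed

lemma gcg_step_models_of_subset:
  "gcg_step M\<^sub>0 \<Phi> S \<psi> g c c' \<Longrightarrow> models_of M\<^sub>0 (fst c') \<subseteq> models_of M\<^sub>0 (fst c)"
  by (induction rule: gcg_step.induct) (auto simp: models_of_And_Neg)

text \<open>Started at \<open>gcg_init \<Phi>\<close>, this places every chosen assignment among the
  models of \<open>\<Phi>\<close>, the domain on which \<open>eq_class\<close> and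
  \<open>proper\<close> give information.\<close>

lemma gcg_reachable_models_of_subset:
  "(gcg_step M\<^sub>0 \<Phi> S \<psi> g)\<^sup>*\<^sup>* c c' \<Longrightarrow> models_of M\<^sub>0 (fst c') \<subseteq> models_of M\<^sub>0 (fst c)"
  by (induction rule: rtranclp_induct) (auto dest!: gcg_step_models_of_subset)

text \<open>The chosen \<open>\<sigma>\<close> is itself lost: when reported, it belongs to its own
  class; when excluded, it satisfies \<open>g \<sigma>\<close> by properness. Both facts require
  \<open>\<sigma>\<close> to be a model of \<open>\<Phi>\<close>, hence the bound on the models at
  \<open>c\<close>.\<close>

lemma gcg_step_models_of_psubset:
  assumes "wf_lts M\<^sub>0" "proper M\<^sub>0 \<Phi> S \<psi> g"
    and "gcg_step M\<^sub>0 \<Phi> S \<psi> g c c'" "models_of M\<^sub>0 (fst c) \<subseteq> models_of M\<^sub>0 \<Phi>"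
  shows "models_of M\<^sub>0 (fst c') \<subset> models_of M\<^sub>0 (fst c)"
  using assms(3,4)
proof (induction rule: gcg_step.induct)
  case (report \<sigma> \<phi> outs)
  then have "\<sigma> \<in> assignments (vars M\<^sub>0)" "\<sigma> \<in> eq_class M\<^sub>0 \<Phi> \<sigma>"
    by (auto simp: models_of_def[of _ \<phi>] eq_class_def asg_equiv_refl)
  then have "\<sigma> \<Turnstile> class_form M\<^sub>0 \<Phi> \<sigma>"
    using assms(1) by (simp add: sat_class_form)
  then show ?case
    using report by (auto simp: models_of_And_Neg)
next
  case (exclude \<sigma> \<phi> outs)
  then show ?case
    using assms(2) by (auto simp: models_of_And_Neg proper_def)
qed

lemma gcg_terminating_if_proper:
  assumes "wf_lts M\<^sub>0" "proper M\<^sub>0 \<Phi> S \<psi> g"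
  shows "gcg_terminating M\<^sub>0 \<Phi> S \<psi> g"
  unfolding gcg_terminating_def
proof
  assume "\<exists>c. c 0 = gcg_init \<Phi> \<and> (\<forall>i. gcg_step M\<^sub>0 \<Phi> S \<psi> g (c i) (c (Suc i)))"
  then obtain c where init: "c 0 = gcg_init \<Phi>"
    and step: "\<And>i. gcg_step M\<^sub>0 \<Phi> S \<psi> g (c i) (c (Suc i))"
    by blast
  \<comment> \<open>This bound makes the strict decrease available at every index, so an infinite
    execution would be an infinite descending chain in \<open>finite_psubset\<close>.\<close>
  have "models_of M\<^sub>0 (fst (c i)) \<subseteq> models_of M\<^sub>0 \<Phi>" for i
  proof (induction i)
    case 0
    then show ?case by (simp add: init gcg_init_def)
  next
    case (Suc i)
    then show ?case using gcg_step_models_of_subset[OF step[of i]] by blast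
  qed
  then have "\<forall>i. (models_of M\<^sub>0 (fst (c (Suc i))), models_of M\<^sub>0 (fst (c i))) \<in> finite_psubset"
    using gcg_step_models_of_psubset[OF assms step] finite_models_of[OF assms(1)]
    by (simp add: finite_psubset_def)
  then show False
    using wf_no_infinite_down_chainE[OF wf_finite_psubset, of "\<lambda>i. models_of M\<^sub>0 (fst (c i))"] by blast
qed

text \<open>The guard of \<open>report\<close> checks the specification at the moment of output, and
  the chosen assignment satisfies \<open>\<Phi>\<close> because models only shrink along a
  run.\<close>

lemma gcg_sound: "gcg_sound M\<^sub>0 \<Phi> S \<psi> g"
proof -
  let ?sol = "{\<sigma> \<in> models_of M\<^sub>0 \<Phi>. S (lts_of M\<^sub>0 \<sigma>) \<psi>}"
  have "set (snd c) \<subseteq> ?sol" if "(gcg_step M\<^sub>0 \<Phi> S \<psi> g)\<^sup>*\<^sup>* (gcg_init \<Phi>) c" for c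
    using that
  proof (induction rule: rtranclp_induct)
    case base
    then show ?case by (simp add: gcg_init_def)
  next
    case (step c c')
    have "models_of M\<^sub>0 (fst c) \<subseteq> models_of M\<^sub>0 \<Phi>"
      using gcg_reachable_models_of_subset[OF step.hyps(1)] by (simp add: gcg_init_def)
    with step.hyps(2) step.IH show ?case
      by (cases rule: gcg_step.cases) auto
  qed
  then show ?thesis
    unfolding gcg_sound_def by fastforce
qed

lemma gcg_complete_if_proper:
  assumes wf: "wf_lts M\<^sub>0" and proper: "proper M\<^sub>0 \<Phi> S \<psi> g"
  shows "gcg_complete_upto_iso M\<^sub>0 \<Phi> S \<psi> g"
proof -
  \<comment> \<open>Loop invariant: a solution is either still available or already represented by
    an output. Once the formula is unsatisfiable, only the second alternative remains.\<close>
  have "\<rho> \<in> models_of M\<^sub>0 (fst c) \<or> (\<exists>\<sigma> \<in> set (snd c). asg_equiv M\<^sub>0 \<Phi> \<sigma> \<rho>)"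
    if run: "(gcg_step M\<^sub>0 \<Phi> S \<psi> g)\<^sup>*\<^sup>* (gcg_init \<Phi>) c"
      and \<rho>: "\<rho> \<in> models_of M\<^sub>0 \<Phi>" "S (lts_of M\<^sub>0 \<rho>) \<psi>" for \<rho> c
    using run
  proof (induction rule: rtranclp_induct)
    case base
    then show ?case using \<rho> by (simp add: gcg_init_def)
  next
    case (step c c')
    have sub: "models_of M\<^sub>0 (fst c) \<subseteq> models_of M\<^sub>0 \<Phi>"
      using gcg_reachable_models_of_subset[OF step.hyps(1)] by (simp add: gcg_init_def)
    from step.hyps(2) show ?case
    proof (cases rule: gcg_step.cases)
      case (report \<sigma> \<phi> outs)
      have "\<rho> \<Turnstile> class_form M\<^sub>0 \<Phi> \<sigma> \<Longrightarrow> asg_equiv M\<^sub>0 \<Phi> \<sigma> \<rho>"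
        using wf \<rho>(1) by (auto simp: sat_class_form models_of_def eq_class_def intro: asg_equiv_sym)
      then show ?thesis
        using report step.IH by (auto simp: models_of_And_Neg)
    next
      case (exclude \<sigma> \<phi> outs)
      \<comment> \<open>By \<open>sub\<close>, the excluded \<open>\<sigma>\<close> is a
        counterexample among the models of \<open>\<Phi>\<close>, so properness protects the
        solution \<open>\<rho>\<close> from \<open>g \<sigma>\<close>.\<close>
      have "\<not> \<rho> \<Turnstile> g \<sigma>"
        using exclude sub \<rho> proper by (auto simp: proper_def)
      then show ?thesis
        using exclude step.IH by (auto simp: models_of_And_Neg)
    qed
  qed
  then show ?thesis
    unfolding gcg_complete_upto_iso_def satisfiable_iff_models_of by fastforce
qed

theorem theorem4:
  fixes M\<^sub>0 :: "('a, 'q) lts"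
    and \<Phi> :: "('a, 'q) tform"
    and S :: "('a, 'q) lts \<Rightarrow> 'spec \<Rightarrow> bool"
    and \<psi> :: 'spec
    and \<gamma> :: "('a, 'q) generalizer"
  assumes "wf_lts M\<^sub>0"
    and "formula_over (vars M\<^sub>0) \<Phi>"
    and "entails (vars M\<^sub>0) \<Phi> (BigConj (transitions M\<^sub>0) Atom)"
    and "\<And>\<sigma> \<rho>. asg_equiv M\<^sub>0 \<Phi> \<sigma> \<rho> \<Longrightarrow> S (lts_of M\<^sub>0 \<sigma>) \<psi> \<longleftrightarrow> S (lts_of M\<^sub>0 \<rho>) \<psi>"
    and "is_generalizer M\<^sub>0 \<gamma>"
    and "proper M\<^sub>0 \<Phi> S \<psi> \<gamma>"
  shows "gcg_terminating M\<^sub>0 \<Phi> S \<psi> (equiv_closure M\<^sub>0 \<Phi> \<gamma>)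
       \<and> gcg_sound M\<^sub>0 \<Phi> S \<psi> (equiv_closure M\<^sub>0 \<Phi> \<gamma>)
       \<and> gcg_complete_upto_iso M\<^sub>0 \<Phi> S \<psi> (equiv_closure M\<^sub>0 \<Phi> \<gamma>)"
proof -
  have "proper M\<^sub>0 \<Phi> S \<psi> (equiv_closure M\<^sub>0 \<Phi> \<gamma>)"
    using assms(1,4,6) by (rule proper_equiv_closure)
  with assms(1) show ?thesis
    by (simp add: gcg_terminating_if_proper gcg_sound gcg_complete_if_proper)
qed

end
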